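(* Let $X\subseteq\mathbb{R}^n$ be a convex set that is either open in $\mathbb{R}^n$ or a polyhedron, and let $\succcurlyeq$ be a binary relation on $X$. Then the following are equivalent: (1) $\succcurlyeq$ is arc-continuous; (2) $\succcurlyeq$ is continuous; (3) $\succcurlyeq$ is strongly mixture-continuous and strongly Archimedean.
   Context: A polyhedron is an intersection of finitely many closed half-spaces of $\mathbb{R}^n$. No property of $\succcurlyeq$ is assumed. $x\succ y$ iff $x\succcurlyeq y$ and not $y\succcurlyeq x$; $x\preccurlyeq y$ iff $y\succcurlyeq x$; $x\prec y$ iff $y\succ x$. For $R\in\{\succcurlyeq,\preccurlyeq,\succ,\prec\}$, $A_R(x)=\{y\in X: y\,R\,x\}$. An arc is a continuous injective function $m=(m_1,\dots,m_n):[0,1]\to\mathbb{R}^n$; it is smooth if every $m_i$ is continuously differentiable and $m'(\lambda)=(m_1'(\lambda),\dots,m_n'(\lambda))\neq 0$ for all $\lambda\in[0,1]$. A smooth curve is the range of a smooth arc. Let $\mathcal{M}$ be the set of smooth arcs with values in $X$; write $m_{xy}$ for an element $m\in\mathcal{M}$ with $m(1)=x$ and $m(0)=y$. Continuous: for all $x\in X$, $A_\succcurlyeq(x)$ and $A_\preccurlyeq(x)$ are closed in $X$, and $A_\succ(x)$ and $A_\prec(x)$ are open in $X$. Arc-continuous: for every smooth curve $S\subseteq X$ and all $x\in X$ (not only $x\in S$), $A_\succcurlyeq(x)\cap S$ and $A_\preccurlyeq(x)\cap S$ are closed in $S$, and $A_\succ(x)\cap S$ and $A_\prec(x)\cap S$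 are open in $S$. Strongly mixture-continuous: for all $x,y,z\in X$ and all $m_{xy}\in\mathcal{M}$, the sets $\{\lambda\in[0,1]: m_{xy}(\lambda)\succcurlyeq z\}$ and $\{\lambda\in[0,1]: z\succcurlyeq m_{xy}(\lambda)\}$ are closed. Strongly Archimedean: for all $x,y,z\in X$ with $x\succ y$ and all $m_{xz},m_{yz}\in\mathcal{M}$, there exist $\lambda,\delta\in(0,1)$ such that $m_{xz}(\lambda)\succ y$ and $x\succ m_{yz}(\delta)$. *)

theory Defs
  imports "HOL-Analysis.Analysis"
begin

text \<open>
  A binary relation on \<open>X\<close> is given by a predicate \<open>R\<close> on the ambient type, with \<open>R x y\<close> for
  \<open>x \<succcurlyeq> y\<close>. The notions below evaluate \<open>R\<close> at points of \<open>X\<close> only, so the values of \<open>R\<close> outside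
  \<open>X\<close> play no role. The relations \<open>\<succ>\<close>, \<open>\<preccurlyeq>\<close>, \<open>\<prec>\<close> are \<open>strict R\<close>, \<open>R\<inverse>\<inverse>\<close> and \<open>(strict R)\<inverse>\<inverse>\<close>.
\<close>

definition strict :: "('a \<Rightarrow> 'a \<Rightarrow> bool) \<Rightarrow> 'a \<Rightarrow> 'a \<Rightarrow> bool"
  where "strict R x y \<longleftrightarrow> R x y \<and> \<not> R y x"

definition section_of :: "'a set \<Rightarrow> ('a \<Rightarrow> 'a \<Rightarrow> bool) \<Rightarrow> 'a \<Rightarrow> 'a set"
  where "section_of X R x = {y \<in> X. R y x}"

text \<open>
  The derivative is taken within the unit interval, hence is one-sided at the end points: the values
  of \<open>m\<close> outside the interval are irrelevant. For this reason \<open>C1_differentiable_on\<close>, which uses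
  two-sided derivatives, is not used.
\<close>

definition smooth_arc :: "(real \<Rightarrow> 'a::real_normed_vector) \<Rightarrow> bool"
  where "smooth_arc m \<longleftrightarrow> arc m \<and>
    (\<exists>m'. continuous_on {0..1} m' \<and>
      (\<forall>t\<in>{0..1}. (m has_vector_derivative m' t) (at t within {0..1}) \<and> m' t \<noteq> 0))"

definition smooth_curve :: "'a::real_normed_vector set \<Rightarrow> bool"
  where "smooth_curve S \<longleftrightarrow> (\<exists>m. smooth_arc m \<and> S = path_image m)"

definition smooth_arcs_in :: "'a::real_normed_vector set \<Rightarrow> (real \<Rightarrow> 'a) set"
  where "smooth_arcs_in X = {m. smooth_arc m \<and> path_image m \<subseteq> X}"

text \<open>\<open>m \<in> smooth_arcs_to_from X x y\<close> starts at \<open>y\<close> and ends at \<open>x\<close>.\<close>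

definition smooth_arcs_to_from :: "'a::real_normed_vector set \<Rightarrow> 'a \<Rightarrow> 'a \<Rightarrow> (real \<Rightarrow> 'a) set"
  where "smooth_arcs_to_from X x y = {m \<in> smooth_arcs_in X. m 1 = x \<and> m 0 = y}"

definition continuous_relation :: "'a::topological_space set \<Rightarrow> ('a \<Rightarrow> 'a \<Rightarrow> bool) \<Rightarrow> bool"
  where "continuous_relation X R \<longleftrightarrow> (\<forall>x\<in>X.
    closedin (top_of_set X) (section_of X R x) \<and>
    closedin (top_of_set X) (section_of X (R\<inverse>\<inverse>) x) \<and>
    openin (top_of_set X) (section_of X (strict R) x) \<and>
    openin (top_of_set X) (section_of X ((strict R)\<inverse>\<inverse>) x))"

definition arc_continuous :: "'a::real_normed_vector set \<Rightarrow> ('a \<Rightarrow> 'a \<Rightarrow> bool) \<Rightarrow> bool"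
  where "arc_continuous X R \<longleftrightarrow> (\<forall>S. smooth_curve S \<and> S \<subseteq> X \<longrightarrow> (\<forall>x\<in>X.
    closedin (top_of_set S) (section_of X R x \<inter> S) \<and>
    closedin (top_of_set S) (section_of X (R\<inverse>\<inverse>) x \<inter> S) \<and>
    openin (top_of_set S) (section_of X (strict R) x \<inter> S) \<and>
    openin (top_of_set S) (section_of X ((strict R)\<inverse>\<inverse>) x \<inter> S)))"

definition strongly_mixture_continuous ::
    "'a::real_normed_vector set \<Rightarrow> ('a \<Rightarrow> 'a \<Rightarrow> bool) \<Rightarrow> bool"
  where "strongly_mixture_continuous X R \<longleftrightarrow>
    (\<forall>x\<in>X. \<forall>y\<in>X. \<forall>z\<in>X. \<forall>m\<in>smooth_arcs_to_from X x y.
      closed {t \<in> {0..1}. R (m t) z} \<and> closed {t \<in> {0..1}. R z (m t)})"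

definition strongly_Archimedean ::
    "'a::real_normed_vector set \<Rightarrow> ('a \<Rightarrow> 'a \<Rightarrow> bool) \<Rightarrow> bool"
  where "strongly_Archimedean X R \<longleftrightarrow>
    (\<forall>x\<in>X. \<forall>y\<in>X. \<forall>z\<in>X. strict R x y \<longrightarrow>
      (\<forall>m\<in>smooth_arcs_to_from X x z. \<forall>m'\<in>smooth_arcs_to_from X y z.
        \<exists>s\<in>{0<..<1}. \<exists>t\<in>{0<..<1}. strict R (m s) y \<and> strict R x (m' t)))"

end

theory Submission
  imports Defs
begin

text \<open>
  The crux is that closedness in \<open>X\<close> can be tested along smooth curves. Given \<open>y\<^sub>k \<rightarrow> x\<close> in \<open>X\<close>, pass to a
  subsequence whose directions converge, \<open>y\<^sub>k = x + r\<^sub>k w\<^sub>k\<close> with \<open>w\<^sub>k \<rightarrow> v \<noteq> 0\<close>, with \<open>r\<^sub>k\<close> and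
  \<open>w\<^sub>k - v\<close> decaying geometrically. With a \<open>C\<^sup>1\<close> bump \<open>\<beta>\<close> around \<open>1\<close>, the series
  \<open>x + t v + \<Sum>\<^sub>k t \<beta>(t / r\<^sub>k) (w\<^sub>k - v)\<close> is a smooth arc through all the \<open>y\<^sub>k\<close> with end point \<open>x\<close>. Its
  terms have disjoint supports, so it stays in the convex hull of \<open>x\<close>, \<open>x + v\<close> and the points \<open>x + w\<^sub>k\<close>.
  These can be chosen in \<open>X\<close>, since near \<open>x\<close> an open set or a polyhedron agrees with a closed cone.

  For the step from mixture-continuity and the Archimedean property to openness along an arc \<open>m\<close>: if
  \<open>m a \<succ> z\<close> and \<open>a\<close> were an end point of a gap of the closed set \<open>{t. m t \<succcurlyeq> z}\<close>, then the
  Archimedean property, applied to an arc running from inside the gap to \<open>m a\<close>, would give a point of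
  that set in the gap.
\<close>

subsection \<open>A continuously differentiable bump\<close>

text \<open>Squaring the positive part of the parabola makes the function C^1 at the ends 1/2 and
  3/2 of its support.\<close>

definition bump :: "real \<Rightarrow> real"
  where "bump s = (max 0 (1 - 4 * (s - 1)\<^sup>2))\<^sup>2"

lemma bump_bounds: "0 \<le> bump s" "bump s \<le> 1"
  by (auto simp: bump_def intro!: power_le_one)

lemma bump_1: "bump 1 = 1"
  by (simp add: bump_def)

lemma bump_nonzeroD: "bump s \<noteq> 0 \<Longrightarrow> 1/2 < s \<and> s < 3/2"
proof -
  assume "bump s \<noteq> 0"
  then have "\<bar>s - 1\<bar>\<^sup>2 < (1/2)\<^sup>2"
    by (auto simp: bump_def max_def power2_eq_square split: if_splits)
  then have "\<bar>s - 1\<bar> < 1/2"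
    by (rule power2_less_imp_less) simp
  then show ?thesis by (auto simp: abs_if split: if_splits)
qed

text \<open>Away from 0 the function is locally 0 or \<open>s\<^sup>2\<close>; at 0 the difference
  quotient is bounded by \<open>\<bar>h\<bar>\<close>.\<close>

lemma has_field_derivative_max0_power2:
  "((\<lambda>s::real. (max 0 s)\<^sup>2) has_field_derivative 2 * max 0 s) (at s)"
proof -
  consider "s < 0" | "s > 0" | "s = 0" by linarith
  then show ?thesis
  proof cases
    case 1
    have "((\<lambda>s::real. 0) has_field_derivative 2 * max 0 s) (at s)"
      using 1 by simp
    then show ?thesis
      by (rule has_field_derivative_transform_within_open[where S = "{..<0}"]) (use 1 in auto)
  next
    case 2
    have "((\<lambda>s::real. s\<^sup>2) has_field_derivative 2 * max 0 s) (at s)"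
      using 2 by (auto intro!: derivative_eq_intros)
    then show ?thesis
      by (rule has_field_derivative_transform_within_open[where S = "{0<..}"]) (use 2 in auto)
  next
    case 3
    have "((\<lambda>h::real. (max 0 h)\<^sup>2 / h) \<longlongrightarrow> 0) (at 0)"
    proof (rule Lim_null_comparison)
      show "\<forall>\<^sub>F h::real in at 0. norm ((max 0 h)\<^sup>2 / h) \<le> \<bar>h\<bar>"
        by (auto simp: max_def power2_eq_square intro!: always_eventually)
      show "((\<lambda>h::real. \<bar>h\<bar>) \<longlongrightarrow> 0) (at 0)"
        by (rule tendsto_rabs_zero[OF tendsto_ident_at])
    qed
    then show ?thesis using 3 by (simp add: DERIV_def)
  qed
qed

text \<open>The derivative of \<open>s * bump s\<close>. With \<open>s = t / r k\<close>, the
  coefficient \<open>t * bump (t / r k)\<close> is \<open>r k\<close> times this product, so its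
  slope is bounded independently of \<open>r k\<close>.\<close>

definition bump_slope :: "real \<Rightarrow> real"
  where "bump_slope s = bump s - 16 * s * (s - 1) * max 0 (1 - 4 * (s - 1)\<^sup>2)"

lemma has_field_derivative_mult_bump:
  "((\<lambda>s. s * bump s) has_field_derivative bump_slope s) (at s)"
proof -
  have "((\<lambda>s. (max 0 (1 - 4 * (s - 1)\<^sup>2))\<^sup>2) has_field_derivative
      2 * max 0 (1 - 4 * (s - 1)\<^sup>2) * (- 8 * (s - 1))) (at s)"
    by (rule DERIV_chain2[OF has_field_derivative_max0_power2])
      (auto intro!: derivative_eq_intros)
  then have *: "(bump has_field_derivative
      2 * max 0 (1 - 4 * (s - 1)\<^sup>2) * (- 8 * (s - 1))) (at s)"
    unfolding bump_def[abs_def] .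
  show ?thesis
    by (rule DERIV_cong[OF DERIV_mult[OF DERIV_ident *]]) (simp add: bump_slope_def algebra_simps)
qed

lemma continuous_on_bump_slope: "continuous_on A bump_slope"
  unfolding bump_slope_def[abs_def] bump_def by (intro continuous_intros)

text \<open>Off the support of \<open>bump\<close> both terms vanish; on it the second is at most 16
  * (3/2) * (1/2) = 12 in absolute value and the first at most 1.\<close>

lemma bump_slope_bound: "\<bar>bump_slope s\<bar> \<le> 13"
proof (cases "bump s = 0")
  case True
  then show ?thesis by (simp add: bump_slope_def bump_def)
next
  case False
  then have s: "\<bar>s\<bar> \<le> 3/2" "\<bar>s - 1\<bar> \<le> 1/2"
    using bump_nonzeroD[of s] by linarith+
  have "\<bar>s\<bar> * \<bar>s - 1\<bar> * \<bar>max 0 (1 - 4 * (s - 1)\<^sup>2)\<bar> \<le> 3/2 * (1/2) * 1"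
    by (intro mult_mono s) auto
  then have "\<bar>16 * s * (s - 1) * max 0 (1 - 4 * (s - 1)\<^sup>2)\<bar> \<le> 12"
    by (simp add: abs_mult)
  then show ?thesis using bump_bounds[of s] unfolding bump_slope_def by linarith
qed

subsection \<open>Smooth arcs through convergent sequences\<close>

text \<open>The M-test makes the differentiated series converge uniformly, so convergence of the
  original series at the single point \<open>t0\<close> suffices for termwise
  differentiation.\<close>

lemma has_vector_derivative_series:
  fixes f :: "nat \<Rightarrow> real \<Rightarrow> 'a::banach"
  assumes "convex S" and "t0 \<in> S"
    and deriv: "\<And>k t. t \<in> S \<Longrightarrow> (f k has_vector_derivative f' k t) (at t within S)"
    and bound: "\<And>k t. t \<in> S \<Longrightarrow> norm (f' k t) \<le> M k"
    and "summable M" and "summable (\<lambda>k. f k t0)" and "t \<in> S"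
  shows "((\<lambda>t. \<Sum>k. f k t) has_vector_derivative (\<Sum>k. f' k t)) (at t within S)"
proof -
  have ul: "uniform_limit S (\<lambda>n t. \<Sum>k<n. f' k t) (\<lambda>t. \<Sum>k. f' k t) sequentially"
    by (rule Weierstrass_m_test[OF bound \<open>summable M\<close>])
  have "\<forall>\<^sub>F n in sequentially. \<forall>t\<in>S. \<forall>h.
      norm ((\<Sum>k<n. h *\<^sub>R f' k t) - h *\<^sub>R (\<Sum>k. f' k t)) \<le> e * norm h" if "e > 0" for e
    using uniform_limitD[OF ul that]
  proof eventually_elim
    case (elim n)
    have "norm ((\<Sum>k<n. h *\<^sub>R f' k t) - h *\<^sub>R (\<Sum>k. f' k t)) \<le> e * norm h" if "t \<in> S" for t h
    proof -
      have "norm ((\<Sum>k<n. h *\<^sub>R f' k t) - h *\<^sub>R (\<Sum>k. f' k t))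
          = \<bar>h\<bar> * dist (\<Sum>k<n. f' k t) (\<Sum>k. f' k t)"
        by (simp add: dist_norm scaleR_sum_right[symmetric] scaleR_diff_right[symmetric])
      also have "\<dots> \<le> \<bar>h\<bar> * e"
        using elim that by (intro mult_left_mono) (auto intro: less_imp_le)
      finally show ?thesis by (simp add: mult.commute)
    qed
    then show ?case by blast
  qed
  from has_derivative_series[OF \<open>convex S\<close> deriv[unfolded has_vector_derivative_def] this \<open>t0 \<in> S\<close>
      summable_sums[OF \<open>summable (\<lambda>k. f k t0)\<close>]]
  obtain g where g: "\<And>t. t \<in> S \<Longrightarrow> (\<lambda>k. f k t) sums g t"
    "\<And>t. t \<in> S \<Longrightarrow> (g has_derivative (\<lambda>h. h *\<^sub>R (\<Sum>k. f' k t))) (at t within S)"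
    by blast
  have "(g has_vector_derivative (\<Sum>k. f' k t)) (at t within S)"
    using g(2)[OF \<open>t \<in> S\<close>] by (simp add: has_vector_derivative_def)
  then show ?thesis
    by (rule has_vector_derivative_transform[OF \<open>t \<in> S\<close>, rotated]) (simp add: sums_unique[OF g(1), symmetric])
qed

text \<open>Subtracting \<open>t *\<^sub>R v\<close> leaves a map with Lipschitz constant
  \<open>B < norm v\<close>, too slow to undo the motion along \<open>v\<close>, whence injectivity.
  A derivative within \<open>B\<close> of \<open>v\<close> cannot vanish.\<close>

lemma smooth_arcI_derivative_near:
  fixes v :: "'a::real_normed_vector"
  assumes deriv: "\<And>t. t \<in> {0..1} \<Longrightarrow> (g has_vector_derivative g' t) (at t within {0..1})"
    and cont: "continuous_on {0..1} g'"
    and near: "\<And>t. t \<in> {0..1} \<Longrightarrow> norm (g' t - v) \<le> B" and "B < norm v"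
  shows "smooth_arc g"
proof -
  have "inj_on g {0..1}"
  proof (rule inj_onI)
    fix a b :: real
    assume ab: "a \<in> {0..1}" "b \<in> {0..1}" "g a = g b"
    have "norm ((g a - a *\<^sub>R v) - (g b - b *\<^sub>R v)) \<le> B * norm (a - b)"
    proof (rule differentiable_bound[OF _ _ _ ab(1,2)])
      show "((\<lambda>t. g t - t *\<^sub>R v) has_derivative (\<lambda>h. h *\<^sub>R (g' t - v))) (at t within {0..1})"
        if "t \<in> {0..1}" for t
        using deriv[OF that] unfolding has_vector_derivative_def
        by (auto intro!: derivative_eq_intros simp: algebra_simps)
      show "onorm (\<lambda>h. h *\<^sub>R (g' t - v)) \<le> B" if "t \<in> {0..1}" for t
        by (rule onorm_le) (use near[OF that] in \<open>simp add: mult.commute[of B] mult_left_mono\<close>)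
    qed simp
    also have "(g a - a *\<^sub>R v) - (g b - b *\<^sub>R v) = (b - a) *\<^sub>R v"
      using ab(3) by (simp add: algebra_simps)
    finally have "norm v * \<bar>a - b\<bar> \<le> B * \<bar>a - b\<bar>"
      by (simp add: abs_minus_commute mult.commute)
    then show "a = b"
      using \<open>B < norm v\<close> by (auto simp: mult_le_cancel_right)
  qed
  moreover have "continuous_on {0..1} g"
    unfolding continuous_on_eq_continuous_within
    using deriv has_vector_derivative_continuous by blast
  moreover have "g' t \<noteq> 0" if "t \<in> {0..1}" for t
    using near[OF that] \<open>B < norm v\<close> by auto
  ultimately show ?thesis
    unfolding smooth_arc_def arc_def path_def using deriv cont by blast
qed

text \<open>
  The constant 52 makes the correction to the derivative \<open>v\<close> at most
  \<open>13 \<cdot> norm v / 52 \<cdot> \<Sum>\<^sub>k 2\<^sup>-\<^sup>k = norm v / 2\<close>, with 13 from \<open>bump_slope_bound\<close>.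
\<close>

lemma smooth_arc_through_sparse_sequence:
  fixes v :: "'a::banach"
  assumes "convex X" "x \<in> X" "v \<noteq> 0" "x + v \<in> X" and wX: "\<And>k. x + w k \<in> X"
    and r: "\<And>k. 0 < r k" "\<And>k. r k \<le> 1" "\<And>k. r (Suc k) \<le> r k / 4"
    and w: "\<And>k. norm (w k - v) \<le> norm v / 52 * (1/2) ^ k"
  obtains g where "g \<in> smooth_arcs_in X" "g 0 = x" "\<And>k. g (r k) = x + r k *\<^sub>R w k"
proof -
  \<comment> \<open>At \<open>t = r k\<close> the bump is 1, so there \<open>f k\<close> turns the
    direction \<open>v\<close> into \<open>w k\<close>.\<close>
  define f where "f = (\<lambda>k t. (t * bump (t / r k)) *\<^sub>R (w k - v))"
  define f' where "f' = (\<lambda>k t. bump_slope (t / r k) *\<^sub>R (w k - v))"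
  define g where "g = (\<lambda>t. x + t *\<^sub>R v + (\<Sum>k. f k t))"
  define M where "M = (\<lambda>k::nat. norm v / 4 * (1/2) ^ k)"
  have "M sums (norm v / 4 * (1 / (1 - 1/2)))"
    unfolding M_def by (intro sums_mult geometric_sums) simp
  then have M: "summable M" "(\<Sum>k. M k) = norm v / 2"
    by (simp_all add: sums_iff)
  have f'_le: "norm (f' k t) \<le> M k" for k t
  proof -
    have "norm (f' k t) \<le> 13 * (norm v / 52 * (1/2) ^ k)"
      unfolding f'_def norm_scaleR real_norm_def
      by (intro mult_mono bump_slope_bound w) auto
    then show ?thesis by (simp add: M_def)
  qed
  have deriv_f: "(f k has_vector_derivative f' k t) (at t within {0..1})" for k t
  proof -
    have "((\<lambda>t. t / r k * bump (t / r k)) has_field_derivative bump_slope (t / r k) * (1 / r k))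
        (at t within {0..1})"
      using r(1)[of k]
      by (intro DERIV_chain2[OF has_field_derivative_mult_bump]) (auto intro!: derivative_eq_intros)
    from DERIV_cmult[OF this, of "r k"]
    have "((\<lambda>t. t * bump (t / r k)) has_field_derivative bump_slope (t / r k))
        (at t within {0..1})"
      using r(1)[of k] by (simp add: less_imp_neq[THEN not_sym])
    from has_vector_derivative_scaleR[OF this has_vector_derivative_const[of "w k - v"]]
    show ?thesis by (simp add: f_def f'_def)
  qed
  have f_0: "f k 0 = 0" for k
    by (simp add: f_def)
  have "((\<lambda>t. \<Sum>k. f k t) has_vector_derivative (\<Sum>k. f' k t)) (at t within {0..1})"
    if "t \<in> {0..1}" for t
    by (rule has_vector_derivative_series[where f = f and f' = f' and M = M and ?t0.0 = 0])
      (use that deriv_f f'_le M(1) in \<open>simp_all add: f_0\<close>)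
  then have deriv_g: "(g has_vector_derivative v + (\<Sum>k. f' k t)) (at t within {0..1})"
    if "t \<in> {0..1}" for t
    unfolding g_def using that by (auto intro!: derivative_eq_intros)
  have ul: "uniform_limit {0..1} (\<lambda>n t. \<Sum>k<n. f' k t) (\<lambda>t. \<Sum>k. f' k t) sequentially"
    by (rule Weierstrass_m_test[OF f'_le M(1)])
  have "continuous_on {0..1} (\<lambda>t. \<Sum>k<n. f' k t)" for n
    unfolding f'_def using r(1)
    by (intro continuous_intros continuous_on_compose2[OF continuous_on_bump_slope[of UNIV]])
      (auto simp: less_imp_neq[THEN not_sym])
  then have "continuous_on {0..1} (\<lambda>t. \<Sum>k. f' k t)"
    by (intro uniform_limit_theorem[OF _ ul]) simp_all
  then have cont: "continuous_on {0..1} (\<lambda>t. v + (\<Sum>k. f' k t))"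
    by (intro continuous_intros)
  have near: "norm (v + (\<Sum>k. f' k t) - v) \<le> norm v / 2" for t
  proof -
    have sn: "summable (\<lambda>k. norm (f' k t))"
      by (rule summable_comparison_test'[OF M(1), of 0]) (simp add: f'_le)
    have "norm (\<Sum>k. f' k t) \<le> (\<Sum>k. norm (f' k t))"
      by (rule summable_norm[OF sn])
    also have "\<dots> \<le> (\<Sum>k. M k)"
      by (rule suminf_le[OF f'_le sn M(1)])
    finally show ?thesis using M(2) by simp
  qed
  have "smooth_arc g"
    by (rule smooth_arcI_derivative_near[OF deriv_g cont near]) (use \<open>v \<noteq> 0\<close> in auto)

  have r_mono: "r k \<le> r j / 4" if "j < k" for j k
    using that
  proof (induction k)
    case (Suc k)
    then show ?case
      using r(3)[of k] r(1)[of k] r(1)[of j] by (cases "j = k") auto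
  qed simp
  \<comment> \<open>The support of \<open>bump (t / r k)\<close> lies between \<open>r k / 2\<close>
    and \<open>3 * r k / 2\<close>, and
    \<open>3 * r k / 2 \<le> 3 * r j / 8 < r j / 2\<close>.\<close>
  have not_both: "bump (t / r j) = 0 \<or> bump (t / r k) = 0" if "j < k" for j k t
  proof (rule ccontr)
    assume "\<not> ?thesis"
    then have "1/2 < t / r j" "t / r k < 3/2"
      using bump_nonzeroD by blast+
    then have "r j / 2 < t" "t < 3 * r k / 2"
      using r(1) by (simp_all add: field_simps)
    then show False using r_mono[OF that] r(1)[of j] by linarith
  qed
  have g_eq: "g t = x + t *\<^sub>R ((1 - bump (t / r k)) *\<^sub>R v + bump (t / r k) *\<^sub>R w k)"
    if "bump (t / r k) \<noteq> 0" for t k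
  proof -
    have "bump (t / r j) = 0" if "j \<noteq> k" for j
      using not_both[of j k t] not_both[of k j t] \<open>bump (t / r k) \<noteq> 0\<close> that by (metis linorder_neqE_nat)
    then have "(\<Sum>k. f k t) = (\<Sum>k\<in>{k}. f k t)"
      by (intro suminf_finite) (auto simp: f_def)
    then show ?thesis
      using r(1)[of k] by (simp add: g_def f_def algebra_simps)
  qed
  have g_eq0: "g t = x + t *\<^sub>R v" if "\<And>k. bump (t / r k) = 0" for t
    by (simp add: g_def f_def that)
  have "g t \<in> X" if t: "t \<in> {0..1}" for t
  proof -
    \<comment> \<open>\<open>b\<close> is the value of the only active bump, or 0 with any
      \<open>k\<close> when none is active. Then \<open>g t\<close> lies between \<open>x\<close>
      and a point of the segment from \<open>x + v\<close> to \<open>x + w k\<close>.\<close>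
    obtain b k where b: "0 \<le> b" "b \<le> 1" and
      g: "g t = x + t *\<^sub>R ((1 - b) *\<^sub>R v + b *\<^sub>R w k)"
    proof (cases "\<forall>k. bump (t / r k) = 0")
      case True
      then show ?thesis using g_eq0 that[of 0] by simp
    next
      case False
      then obtain k where "bump (t / r k) \<noteq> 0" by blast
      then show ?thesis using g_eq that[OF bump_bounds] by blast
    qed
    have "(1 - b) *\<^sub>R (x + v) + b *\<^sub>R (x + w k) \<in> X"
      using b by (intro convexD[OF \<open>convex X\<close> \<open>x + v \<in> X\<close> wX]) auto
    then have "(1 - t) *\<^sub>R x + t *\<^sub>R ((1 - b) *\<^sub>R (x + v) + b *\<^sub>R (x + w k)) \<in> X"
      using t by (intro convexD[OF \<open>convex X\<close> \<open>x \<in> X\<close>]) auto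
    then show ?thesis by (simp add: g algebra_simps)
  qed
  then have "g \<in> smooth_arcs_in X"
    using \<open>smooth_arc g\<close> by (auto simp: smooth_arcs_in_def path_image_def)
  moreover have "g 0 = x"
    using g_eq0[of 0] by (simp add: bump_def)
  moreover have "g (r k) = x + r k *\<^sub>R w k" for k
    using g_eq[of "r k" k] r(1)[of k] by (simp add: bump_1)
  ultimately show ?thesis using that by blast
qed

text \<open>The bounds on radii and directions hold for all large indices, so dependent choice finds
  indices sparse enough for \<open>smooth_arc_through_sparse_sequence\<close>.\<close>

lemma smooth_arc_through_subsequence:
  fixes v :: "'a::banach"
  assumes "convex X" "x \<in> X" "v \<noteq> 0" "x + v \<in> X" "\<And>k. x + w k \<in> X"
    and r: "\<And>k::nat. 0 < r k" "r \<longlonglongrightarrow> 0" and w: "w \<longlonglongrightarrow> v"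
  obtains g \<sigma> where "g \<in> smooth_arcs_in X" "g 0 = x" "\<And>k. r (\<sigma> k) \<le> 1"
    "(\<lambda>k. r (\<sigma> k)) \<longlonglongrightarrow> 0" "\<And>k. g (r (\<sigma> k)) = x + r (\<sigma> k) *\<^sub>R w (\<sigma> k)"
proof -
  have ev_r: "\<forall>\<^sub>F n in sequentially. r n \<le> e" if "e > 0" for e
    using order_tendstoD(2)[OF r(2) that] by eventually_elim simp
  have ev_w: "\<forall>\<^sub>F n in sequentially. norm (w n - v) \<le> norm v / 52 * (1/2) ^ k" for k :: nat
    using tendstoD[OF w, of "norm v / 52 * (1/2) ^ k"] \<open>v \<noteq> 0\<close>
    by (auto simp: dist_norm elim: eventually_mono)
  have ex: "\<exists>n. norm (w n - v) \<le> norm v / 52 * (1/2) ^ k \<and> r n \<le> e" if "e > 0" for k :: nat and e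
    using eventually_happens[OF eventually_conj[OF ev_w[of k] ev_r[OF that]]] by simp
  have "\<exists>\<sigma>. \<forall>k. (norm (w (\<sigma> k) - v) \<le> norm v / 52 * (1/2) ^ k \<and> r (\<sigma> k) \<le> 1) \<and>
      r (\<sigma> (Suc k)) \<le> r (\<sigma> k) / 4"
  proof (rule dependent_nat_choice)
    show "\<exists>n. norm (w n - v) \<le> norm v / 52 * (1/2) ^ 0 \<and> r n \<le> 1"
      using ex[of 1 0] by simp
    show "\<exists>m. (norm (w m - v) \<le> norm v / 52 * (1/2) ^ Suc k \<and> r m \<le> 1) \<and> r m \<le> r n / 4"
      for n k
      using ex[of "min 1 (r n / 4)" "Suc k"] r(1)[of n] by auto
  qed
  then obtain \<sigma> where \<sigma>: "\<And>k. norm (w (\<sigma> k) - v) \<le> norm v / 52 * (1/2) ^ k"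
    "\<And>k. r (\<sigma> k) \<le> 1" "\<And>k. r (\<sigma> (Suc k)) \<le> r (\<sigma> k) / 4"
    by blast
  have r_le: "r (\<sigma> k) \<le> (1/4) ^ k" for k
  proof (induction k)
    case (Suc k)
    then show ?case using \<sigma>(3)[of k] by simp
  qed (use \<sigma>(2) in simp)
  have "(\<lambda>k. r (\<sigma> k)) \<longlonglongrightarrow> 0"
  proof (rule Lim_null_comparison)
    show "\<forall>\<^sub>F k in sequentially. norm (r (\<sigma> k)) \<le> (1/4) ^ k"
      using r_le r(1) by (simp add: less_imp_le)
    show "(\<lambda>k. (1/4) ^ k) \<longlonglongrightarrow> (0::real)"
      by (intro LIMSEQ_power_zero) simp
  qed
  moreover obtain g where "g \<in> smooth_arcs_in X" "g 0 = x"
    "\<And>k. g (r (\<sigma> k)) = x + r (\<sigma> k) *\<^sub>R w (\<sigma> k)"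
    using smooth_arc_through_sparse_sequence[of X x v "w \<circ> \<sigma>" "r \<circ> \<sigma>"] assms(1-5) r(1) \<sigma>
    by (auto simp: o_def)
  ultimately show ?thesis using that \<sigma>(2) by blast
qed

subsection \<open>Reduction of topology to smooth curves\<close>

text \<open>If \<open>x\<close> lies on the bounding hyperplane, the half-space is a cone with apex
  \<open>x\<close> and every \<open>e > 0\<close> works; otherwise any positive \<open>e\<close>
  below the distance to the hyperplane does. The eventual form lets finitely many half-spaces share
  one \<open>e\<close>.\<close>

lemma halfspace_eventually_contains_sgn:
  fixes a :: "'a::real_inner"
  assumes "a \<noteq> 0" and "a \<bullet> x \<le> b"
  shows "\<forall>\<^sub>F e in at_right 0. \<forall>y. a \<bullet> y \<le> b \<longrightarrow> a \<bullet> (x + e *\<^sub>R sgn (y - x)) \<le> b"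
proof (cases "a \<bullet> x = b")
  case True
  have "a \<bullet> (x + e *\<^sub>R sgn (y - x)) \<le> b" if "e > 0" "a \<bullet> y \<le> b" for e y
  proof -
    have "e * (a \<bullet> (y - x) / norm (y - x)) \<le> 0"
      using that True by (intro mult_nonneg_nonpos divide_nonpos_nonneg) (auto simp: inner_diff_right)
    then show ?thesis
      using True by (simp add: inner_add_right sgn_div_norm divide_inverse mult_ac)
  qed
  then show ?thesis
    by (intro eventually_at_rightI[of 0 1]) auto
next
  case False
  have "a \<bullet> (x + e *\<^sub>R sgn (y - x)) \<le> b" if "0 < e" "e < (b - a \<bullet> x) / norm a" for e y
  proof -
    have "a \<bullet> (e *\<^sub>R sgn (y - x)) \<le> norm a * norm (e *\<^sub>R sgn (y - x))"
      by (rule norm_cauchy_schwarz)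
    also have "\<dots> \<le> norm a * e"
      using \<open>0 < e\<close> by (intro mult_left_mono) (auto simp: norm_sgn)
    also have "\<dots> \<le> b - a \<bullet> x"
      using that \<open>a \<noteq> 0\<close> by (simp add: field_simps)
    finally show ?thesis by (simp add: inner_add_right)
  qed
  then show ?thesis
    using assms False by (intro eventually_at_rightI[of 0 "(b - a \<bullet> x) / norm a"]) auto
qed

text \<open>\<open>K\<close> is a closed ball for open \<open>X\<close> and \<open>X\<close> itself
  for a polyhedron. Its closedness keeps limits of the points
  \<open>x + e *\<^sub>R sgn (y - x)\<close> inside \<open>X\<close>.\<close>

lemma open_or_polyhedron_contains_sgn:
  fixes X :: "'a::euclidean_space set"
  assumes X: "open X \<or> polyhedron X" and "x \<in> X"
  obtains e K where "e > 0" "closed K" "K \<subseteq> X"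
    "\<And>y. y \<in> X \<Longrightarrow> x + e *\<^sub>R sgn (y - x) \<in> K"
  using X
proof
  assume "open X"
  then obtain e where e: "e > 0" "cball x e \<subseteq> X"
    using \<open>x \<in> X\<close> open_contains_cball by blast
  then have "x + e *\<^sub>R sgn (y - x) \<in> cball x e" for y
    by (simp add: dist_norm norm_sgn)
  then show ?thesis using that[of e "cball x e"] e by blast
next
  assume "polyhedron X"
  then obtain F where F: "finite F" "X = \<Inter>F"
    and half: "\<And>h. h \<in> F \<Longrightarrow> \<exists>a b. a \<noteq> 0 \<and> h = {y. a \<bullet> y \<le> b}"
    unfolding polyhedron_def by blast
  have "\<forall>\<^sub>F e in at_right 0. \<forall>y\<in>h. x + e *\<^sub>R sgn (y - x) \<in> h" if "h \<in> F" for h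
  proof -
    obtain a b where "a \<noteq> 0" and h: "h = {y. a \<bullet> y \<le> b}" using half \<open>h \<in> F\<close> by blast
    moreover have "a \<bullet> x \<le> b" using \<open>x \<in> X\<close> \<open>h \<in> F\<close> F(2) h by blast
    ultimately show ?thesis
      using halfspace_eventually_contains_sgn[of a x b] by simp
  qed
  then have "\<forall>\<^sub>F e in at_right 0. \<forall>h\<in>F. \<forall>y\<in>h. x + e *\<^sub>R sgn (y - x) \<in> h"
    by (intro eventually_ball_finite[OF \<open>finite F\<close>]) blast
  then have "\<forall>\<^sub>F e in at_right (0::real). (\<forall>h\<in>F. \<forall>y\<in>h. x + e *\<^sub>R sgn (y - x) \<in> h) \<and> 0 < e"
    using eventually_at_right_less by (rule eventually_conj)
  from eventually_happens[OF this]
  obtain e :: real where "0 < e" "\<forall>h\<in>F. \<forall>y\<in>h. x + e *\<^sub>R sgn (y - x) \<in> h"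
    by auto
  then show ?thesis
    using that[of e X] polyhedron_imp_closed[OF \<open>polyhedron X\<close>] F(2) by blast
qed

lemma smooth_arc_imp_continuous_on: "smooth_arc m \<Longrightarrow> continuous_on {0..1} m"
  by (simp add: smooth_arc_def arc_def path_def)

lemma closedin_if_closedin_smooth_curves:
  fixes X :: "'a::euclidean_space set"
  assumes X: "convex X" "open X \<or> polyhedron X" and "T \<subseteq> X"
    and curves: "\<And>S. smooth_curve S \<Longrightarrow> S \<subseteq> X \<Longrightarrow> closedin (top_of_set S) (T \<inter> S)"
  shows "closedin (top_of_set X) T"
  unfolding closedin_limpt
proof (intro conjI allI impI; (elim conjE)?)
  fix x
  assume "x islimpt T" "x \<in> X"
  then obtain y where y: "\<And>k. y k \<in> T - {x}" "y \<longlonglongrightarrow> x"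
    unfolding islimpt_sequential by blast
  obtain e K where e: "e > 0" and K: "closed K" "K \<subseteq> X"
    "\<And>y. y \<in> X \<Longrightarrow> x + e *\<^sub>R sgn (y - x) \<in> K"
    using open_or_polyhedron_contains_sgn[OF X(2) \<open>x \<in> X\<close>] by metis
  \<comment> \<open>Directions are scaled to length \<open>e\<close>, not 1, so that
    \<open>x + w k\<close> lies in \<open>K\<close>; dividing the distance by \<open>e\<close>
    compensates, giving \<open>y k = x + r k *\<^sub>R w k\<close>.\<close>
  define w where "w = (\<lambda>k. e *\<^sub>R sgn (y k - x))"
  define r where "r = (\<lambda>k. norm (y k - x) / e)"
  have "w k \<in> sphere 0 e" for k
    using y(1)[of k] e by (auto simp: w_def norm_sgn)
  then obtain v \<rho> where v: "v \<in> sphere 0 e" and \<rho>: "strict_mono \<rho>" "(w \<circ> \<rho>) \<longlonglongrightarrow> v"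
    using compact_sphere[of "0::'a" e] unfolding compact_def by meson
  have wK: "x + w k \<in> K" for k
    using K(3) y(1)[of k] \<open>T \<subseteq> X\<close> by (auto simp: w_def)
  have "(\<lambda>k. x + (w \<circ> \<rho>) k) \<longlonglongrightarrow> x + v"
    by (intro tendsto_intros \<rho>)
  then have "x + v \<in> K"
    using closed_sequentially[OF K(1)] wK by (metis comp_apply)
  have r_pos: "0 < r k" for k
    using y(1)[of k] e by (auto simp: r_def)
  have "(\<lambda>k. norm (y k - x) / e) \<longlonglongrightarrow> norm (x - x) / e"
    using e by (intro tendsto_intros y) auto
  then have r_lim: "(r \<circ> \<rho>) \<longlonglongrightarrow> 0"
    using LIMSEQ_subseq_LIMSEQ[OF _ \<rho>(1)] by (simp add: r_def)
  have rw: "x + r k *\<^sub>R w k = y k" for k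
    using y(1)[of k] e by (simp add: r_def w_def sgn_div_norm)
  obtain g \<sigma> where g: "g \<in> smooth_arcs_in X" "g 0 = x" and \<sigma>: "\<And>k. r (\<rho> (\<sigma> k)) \<le> 1"
    "(\<lambda>k. r (\<rho> (\<sigma> k))) \<longlonglongrightarrow> 0" and gy: "\<And>k. g (r (\<rho> (\<sigma> k))) = y (\<rho> (\<sigma> k))"
  proof (rule smooth_arc_through_subsequence[of X x v "w \<circ> \<rho>" "r \<circ> \<rho>"])
    show "v \<noteq> 0" using v e by auto
    show "x + v \<in> X" "x + (w \<circ> \<rho>) k \<in> X" for k
      using \<open>x + v \<in> K\<close> wK \<open>K \<subseteq> X\<close> by auto
  qed (use X(1) \<open>x \<in> X\<close> r_pos r_lim \<rho>(2) rw in auto)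
  have sm: "smooth_arc g" and sub: "path_image g \<subseteq> X"
    using g(1) by (auto simp: smooth_arcs_in_def)
  \<comment> \<open>The curve meets \<open>T\<close> at points tending to its end point
    \<open>x\<close>, so closedness along this one curve puts \<open>x\<close> in
    \<open>T\<close>.\<close>
  have "closedin (top_of_set (path_image g)) (T \<inter> path_image g)"
    using curves sm sub unfolding smooth_curve_def by blast
  then obtain C where C: "closed C" "T \<inter> path_image g = path_image g \<inter> C"
    unfolding closedin_closed by blast
  have ran: "r (\<rho> (\<sigma> k)) \<in> {0..1}" for k
    using \<sigma>(1)[of k] r_pos[of "\<rho> (\<sigma> k)"] by auto
  have "g (r (\<rho> (\<sigma> k))) \<in> T \<inter> path_image g" for k
    using y(1) gy ran[of k] unfolding path_image_def by (metis DiffD1 IntI imageI)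
  then have "g (r (\<rho> (\<sigma> k))) \<in> C" for k
    using C(2) by blast
  moreover have "(\<lambda>k. g (r (\<rho> (\<sigma> k)))) \<longlonglongrightarrow> g 0"
    by (rule continuous_on_tendsto_compose[OF smooth_arc_imp_continuous_on[OF sm] \<sigma>(2)])
      (use ran in auto)
  ultimately have "g 0 \<in> C"
    by (rule closed_sequentially[OF C(1)])
  moreover have "g 0 \<in> path_image g"
    by (simp add: path_image_def)
  ultimately show "x \<in> T"
    using C(2) g(2) by blast
qed (rule \<open>T \<subseteq> X\<close>)

lemma openin_if_openin_smooth_curves:
  fixes X :: "'a::euclidean_space set"
  assumes X: "convex X" "open X \<or> polyhedron X" and "T \<subseteq> X"
    and curves: "\<And>S. smooth_curve S \<Longrightarrow> S \<subseteq> X \<Longrightarrow> openin (top_of_set S) (T \<inter> S)"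
  shows "openin (top_of_set X) T"
proof -
  have "closedin (top_of_set X) (X - T)"
  proof (rule closedin_if_closedin_smooth_curves[OF X])
    fix S
    assume S: "smooth_curve S" "S \<subseteq> X"
    have "S - T \<inter> S = (X - T) \<inter> S" using S(2) by blast
    then show "closedin (top_of_set S) ((X - T) \<inter> S)"
      using curves[OF S] by (simp add: openin_closedin_eq)
  qed blast
  then show ?thesis
    using \<open>T \<subseteq> X\<close> by (simp add: openin_closedin_eq)
qed

lemma arc_continuous_iff_continuous_relation:
  fixes X :: "'a::euclidean_space set"
  assumes "convex X" "open X \<or> polyhedron X"
  shows "arc_continuous X R \<longleftrightarrow> continuous_relation X R"
proof
  have sub: "section_of X Q x \<subseteq> X" for Q x
    by (auto simp: section_of_def)
  show "continuous_relation X R" if "arc_continuous X R"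
    unfolding continuous_relation_def
    by (intro ballI conjI closedin_if_closedin_smooth_curves[OF assms sub]
          openin_if_openin_smooth_curves[OF assms sub])
      (use that in \<open>auto simp: arc_continuous_def\<close>)
next
  show "arc_continuous X R" if "continuous_relation X R"
  proof -
    have "closedin (top_of_set S) (A \<inter> S)" if "closedin (top_of_set X) A" "S \<subseteq> X" for A S :: "'a set"
      using that by (auto simp: closedin_closed)
    moreover have "openin (top_of_set S) (A \<inter> S)" if "openin (top_of_set X) A" "S \<subseteq> X" for A S :: "'a set"
      using that by (auto simp: openin_open)
    ultimately show ?thesis
      using that unfolding continuous_relation_def arc_continuous_def by blast
  qed
qed

subsection \<open>Topology of arcs and the Archimedean property\<close>

text \<open>One direction is continuity of \<open>m\<close>. For the other, a closed set of
  parameters is compact, so its image is compact and hence closed.\<close>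

lemma closedin_path_image_iff:
  fixes m :: "real \<Rightarrow> 'a::t2_space"
  assumes "path m"
  shows "closedin (top_of_set (path_image m)) (A \<inter> path_image m) \<longleftrightarrow> closed {t \<in> {0..1}. m t \<in> A}"
    (is "?L \<longleftrightarrow> ?R")
proof
  have m: "continuous_on {0..1} m" using assms by (simp add: path_def)
  have eq: "{0..1} \<inter> m -` (A \<inter> path_image m) = {t \<in> {0..1}. m t \<in> A}"
    by (auto simp: path_image_def)
  show ?R if ?L
  proof -
    have "closedin (top_of_set {0..1}) ({0..1} \<inter> m -` (A \<inter> path_image m))"
      by (rule continuous_closedin_preimage_gen[OF m _ that]) (auto simp: path_image_def)
    then show ?thesis
      unfolding eq by (rule closedin_closed_trans) simp
  qed
  show ?L if ?R
  proof -
    have "compact {t \<in> {0..1}. m t \<in> A}"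
      using that by (auto simp: compact_eq_bounded_closed intro: bounded_subset[of "{0..1}"])
    then have "compact (m ` {t \<in> {0..1}. m t \<in> A})"
      by (intro compact_continuous_image continuous_on_subset[OF m]) auto
    moreover have "m ` {t \<in> {0..1}. m t \<in> A} = A \<inter> path_image m"
      by (auto simp: path_image_def)
    ultimately show ?thesis
      by (metis closed_subset compact_imp_closed inf_le2)
  qed
qed

lemma openin_path_image_iff:
  fixes m :: "real \<Rightarrow> 'a::t2_space"
  assumes "path m"
  shows "openin (top_of_set (path_image m)) (A \<inter> path_image m) \<longleftrightarrow>
    openin (top_of_set {0..1}) {t \<in> {0..1}. m t \<in> A}"
proof -
  have "path_image m - A \<inter> path_image m = - A \<inter> path_image m" by blast
  then have "openin (top_of_set (path_image m)) (A \<inter> path_image m) \<longleftrightarrow>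
      closed {t \<in> {0..1}. m t \<in> - A}"
    using closedin_path_image_iff[OF assms, of "- A"] by (simp add: openin_closedin_eq)
  also have "{t \<in> {0..1}. m t \<in> - A} = {0..1} - {t \<in> {0..1}. m t \<in> A}" by blast
  also have "closed \<dots> \<longleftrightarrow> openin (top_of_set {0..1}) {t \<in> {0..1}. m t \<in> A}"
    by (auto simp: openin_closedin_eq intro: closed_subset closedin_closed_trans)
  finally show ?thesis .
qed

section \<open>Consequences of arc-continuity\<close>

lemma smooth_arcs_to_fromD:
  assumes "m \<in> smooth_arcs_to_from X x y"
  shows "path m" "smooth_arc m" "path_image m \<subseteq> X" "m 1 = x" "m 0 = y"
  using assms by (auto simp: smooth_arcs_to_from_def smooth_arcs_in_def smooth_arc_def arc_def)

lemma arc_continuous_imp_strongly_mixture_continuous: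
  assumes "arc_continuous X R"
  shows "strongly_mixture_continuous X R"
  unfolding strongly_mixture_continuous_def
proof (intro ballI)
  fix x y z m
  assume z: "z \<in> X" and "m \<in> smooth_arcs_to_from X x y"
  note m = smooth_arcs_to_fromD[OF this(2)]
  have "closedin (top_of_set (path_image m)) (section_of X R z \<inter> path_image m)"
    "closedin (top_of_set (path_image m)) (section_of X (R\<inverse>\<inverse>) z \<inter> path_image m)"
    using assms m(2,3) z by (auto simp: arc_continuous_def smooth_curve_def)
  moreover have "{t \<in> {0..1}. m t \<in> section_of X Q z} = {t \<in> {0..1}. Q (m t) z}" for Q
    using m(3) by (auto simp: section_of_def path_image_def)
  ultimately show "closed {t \<in> {0..1}. R (m t) z} \<and> closed {t \<in> {0..1}. R z (m t)}"
    by (simp add: closedin_path_image_iff[OF m(1)])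
qed

lemma openin_unit_interval_meets_interior:
  assumes "openin (top_of_set {0..1::real}) T" and "1 \<in> T"
  shows "\<exists>s\<in>{0<..<1}. s \<in> T"
proof -
  obtain e where e: "e > 0" "\<And>s. s \<in> {0..1} \<Longrightarrow> dist s 1 < e \<Longrightarrow> s \<in> T"
    using assms unfolding openin_euclidean_subtopology_iff by blast
  \<comment> \<open>The maximum with 1/2 keeps the point positive even when \<open>e\<close> is
    large.\<close>
  have "max (1/2) (1 - e/2) \<in> T"
    using e(1) by (intro e(2)) (auto simp: dist_real_def)
  then show ?thesis
    using e(1) by (intro bexI[of _ "max (1/2) (1 - e/2)"]) auto
qed

lemma arc_continuous_imp_strongly_Archimedean:
  assumes "arc_continuous X R"
  shows "strongly_Archimedean X R"
proof -
  \<comment> \<open>The parameter 1 lies in the relatively open set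
    \<open>{t \<in> {0..1}. Q (m t) y}\<close>, hence so does an interior one. Each choice of
    \<open>Q\<close> gives one half of the Archimedean property.\<close>
  have key: "\<exists>s\<in>{0<..<1}. Q (m s) y"
    if "Q = strict R \<or> Q = (strict R)\<inverse>\<inverse>" "y \<in> X" "Q x y" "m \<in> smooth_arcs_to_from X x z" for Q x y z m
  proof -
    note m = smooth_arcs_to_fromD[OF that(4)]
    have "openin (top_of_set (path_image m)) (section_of X Q y \<inter> path_image m)"
      using assms m(2,3) that(1,2) by (auto simp: arc_continuous_def smooth_curve_def)
    moreover have "{t \<in> {0..1}. m t \<in> section_of X Q y} = {t \<in> {0..1}. Q (m t) y}"
      using m(3) by (auto simp: section_of_def path_image_def)
    ultimately have "openin (top_of_set {0..1}) {t \<in> {0..1}. Q (m t) y}"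
      by (simp add: openin_path_image_iff[OF m(1)])
    from openin_unit_interval_meets_interior[OF this] show ?thesis
      using that(3) m(4) by auto
  qed
  show ?thesis
    unfolding strongly_Archimedean_def
  proof (intro ballI impI)
    fix x y z m m'
    assume "x \<in> X" "y \<in> X" "strict R x y"
      and "m \<in> smooth_arcs_to_from X x z" "m' \<in> smooth_arcs_to_from X y z"
    then show "\<exists>s\<in>{0<..<1}. \<exists>t\<in>{0<..<1}. strict R (m s) y \<and> strict R x (m' t)"
      using key[of "strict R" y x m z] key[of "(strict R)\<inverse>\<inverse>" x y m' z] by auto
  qed
qed

section \<open>Openness of strict sections along an arc\<close>

lemma smooth_arc_linepath:
  "p \<noteq> q \<Longrightarrow> smooth_arc (linepath p q)"
  by (rule smooth_arcI_derivative_near[where g' = "\<lambda>_. q - p" and v = "q - p" and B = 0])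
    (auto intro: has_vector_derivative_linepath_within)

text \<open>The chain rule multiplies the derivative by the nonzero constant \<open>a - c\<close>.
  Allowing \<open>c\<close> on either side of \<open>a\<close> covers approaches to \<open>a\<close>
  from both directions.\<close>

lemma smooth_arc_subarc:
  assumes "smooth_arc m" and ac: "c \<in> {0..1}" "a \<in> {0..1}" "c \<noteq> a"
  shows "smooth_arc (m \<circ> linepath c a)"
proof -
  obtain m' where m': "continuous_on {0..1} m'"
    "\<And>t. t \<in> {0..1} \<Longrightarrow> (m has_vector_derivative m' t) (at t within {0..1})"
    "\<And>t. t \<in> {0..1} \<Longrightarrow> m' t \<noteq> 0"
    and m: "continuous_on {0..1} m" "inj_on m {0..1}"
    using assms(1) unfolding smooth_arc_def arc_def path_def by blast
  have l: "linepath c a ` {0..1} \<subseteq> {0..1}"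
    using closed_segment_subset[OF ac(1,2)] by (simp add: path_image_def[symmetric])
  have "inj_on (linepath c a) {0..1}"
    using arc_linepath[OF ac(3)] by (simp add: arc_def)
  then have "arc (m \<circ> linepath c a)"
    unfolding arc_def path_def using m l
    by (meson comp_inj_on continuous_on_compose continuous_on_linepath continuous_on_subset inj_on_subset)
  moreover have "((m \<circ> linepath c a) has_vector_derivative (a - c) *\<^sub>R m' (linepath c a s)) (at s within {0..1})"
    if "s \<in> {0..1}" for s
    using that l by (intro vector_diff_chain_within has_vector_derivative_linepath_within
        has_vector_derivative_within_subset[OF m'(2)]) blast+
  moreover have "continuous_on {0..1} (\<lambda>s. (a - c) *\<^sub>R m' (linepath c a s))"
    using l by (intro continuous_intros continuous_on_compose2[OF m'(1)]) auto
  moreover have "(a - c) *\<^sub>R m' (linepath c a s) \<noteq> 0" if "s \<in> {0..1}" for s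
  proof -
    have "linepath c a s \<in> {0..1}" using l that by blast
    then show ?thesis using m'(3) ac(3) by simp
  qed
  ultimately show ?thesis
    unfolding smooth_arc_def by blast
qed

text \<open>Walking from a bad point towards \<open>t0\<close>, the first point of \<open>W\<close> met would violate \<open>near\<close>.\<close>

lemma openin_diff_if_meets_open_segments:
  fixes I W V :: "'a::euclidean_space set"
  assumes "convex I" "closed W" "closed V" "W \<subseteq> I"
    and near: "\<And>a b. a \<in> W - V \<Longrightarrow> b \<in> I \<Longrightarrow> a \<noteq> b \<Longrightarrow> open_segment a b \<inter> W \<noteq> {}"
  shows "openin (top_of_set I) (W - V)"
  unfolding openin_euclidean_subtopology_iff
proof (intro conjI ballI)
  fix t0
  assume t0: "t0 \<in> W - V"
  then obtain d where d: "d > 0" "ball t0 d \<inter> V = {}"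
    using openE[of "- V" t0] \<open>closed V\<close> by (auto simp: closed_def disjoint_eq_subset_Compl)
  have "b \<in> W - V" if b: "b \<in> I" "dist b t0 < d" for b
  proof (rule ccontr)
    assume "b \<notin> W - V"
    have bb: "b \<in> ball t0 d" using b by (simp add: dist_commute)
    then have "b \<notin> W" using \<open>b \<notin> W - V\<close> d(2) by blast
    have "closed (W \<inter> closed_segment t0 b)" "W \<inter> closed_segment t0 b \<noteq> {}"
      using \<open>closed W\<close> t0 by auto
    then obtain a where a: "a \<in> W" "a \<in> closed_segment t0 b"
      and min: "\<And>t. t \<in> W \<inter> closed_segment t0 b \<Longrightarrow> dist b a \<le> dist b t"
      using distance_attains_inf[of "W \<inter> closed_segment t0 b" b] by blast
    \<comment> \<open>Balls are convex, so the whole segment misses \<open>V\<close>; the point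
      \<open>a\<close> of \<open>W\<close> nearest to \<open>b\<close> is thus in
      \<open>W - V\<close>, and \<open>near\<close> applies to it.\<close>
    have "closed_segment t0 b \<subseteq> ball t0 d"
      using d(1) bb by (intro closed_segment_subset) auto
    then have "a \<in> W - V" using a d(2) by blast
    moreover have "a \<noteq> b" using a(1) \<open>b \<notin> W\<close> by blast
    ultimately obtain t where t: "t \<in> open_segment a b" "t \<in> W"
      using near b(1) by blast
    have "t \<in> closed_segment t0 b"
      using t(1) a(2) by (meson closed_segment_subset convex_closed_segment ends_in_segment(2)
          open_closed_segment subset_iff)
    moreover have "dist b t < dist b a"
      using dist_in_open_segment[OF t(1)] by (auto simp: dist_commute)
    ultimately show False using min[of t] t(2) by auto
  qed
  then show "\<exists>e>0. \<forall>t\<in>I. dist t t0 < e \<longrightarrow> t \<in> W - V"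
    using d(1) by blast
qed (use \<open>W \<subseteq> I\<close> in blast)

text \<open>The set is a difference \<open>W - V\<close> of sets closed by mixture-continuity. The
  Archimedean property, given an arc ending at \<open>m a\<close>, shows that open segments from
  \<open>a \<in> W - V\<close> meet \<open>W\<close>.\<close>

lemma smooth_arc_openin_strict:
  assumes "convex X" and arch: "strongly_Archimedean X R"
    and mix: "strongly_mixture_continuous X R" and m: "m \<in> smooth_arcs_in X" and "z \<in> X"
  shows "openin (top_of_set {0..1}) {t \<in> {0..1}. strict R (m t) z}"
proof -
  have sm: "smooth_arc m" and mX: "\<And>t. t \<in> {0..1} \<Longrightarrow> m t \<in> X"
    using m by (auto simp: smooth_arcs_in_def path_image_def)
  have inj: "inj_on m {0..1}" using sm by (simp add: smooth_arc_def arc_def)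
  define W where "W = {t \<in> {0..1}. R (m t) z}"
  define V where "V = {t \<in> {0..1}. R z (m t)}"
  have "m \<in> smooth_arcs_to_from X (m 1) (m 0)"
    using m by (simp add: smooth_arcs_to_from_def)
  moreover have "m 1 \<in> X" "m 0 \<in> X" using mX by auto
  ultimately have "closed W" "closed V"
    using mix \<open>z \<in> X\<close> unfolding strongly_mixture_continuous_def W_def V_def by blast+
  moreover have "open_segment a b \<inter> W \<noteq> {}" if a: "a \<in> W - V" and b: "b \<in> {0..1}" "a \<noteq> b" for a b
  proof -
    have a01: "a \<in> {0..1}" and xz: "strict R (m a) z"
      using a by (auto simp: W_def V_def strict_def)
    have ab: "closed_segment a b \<subseteq> {0..1}"
      using a01 b(1) by (intro closed_segment_subset) auto
    \<comment> \<open>By injectivity at most one parameter is mapped to \<open>z\<close>; avoiding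
      it gives \<open>m c \<noteq> z\<close>, so the straight path from \<open>m c\<close> to
      \<open>z\<close> is a smooth arc.\<close>
    have "infinite (open_segment a b - (m -` {z} \<inter> {0..1}))"
      using b(2) by (intro Diff_infinite_finite finite_vimage_IntI[OF _ inj]) auto
    from infinite_imp_nonempty[OF this]
    obtain c where c: "c \<in> open_segment a b" and "c \<notin> m -` {z} \<inter> {0..1}"
      by blast
    have c01: "c \<in> {0..1}"
      using c ab open_closed_segment by blast
    then have mc: "m c \<noteq> z" using \<open>c \<notin> _\<close> by blast
    have "c \<noteq> a" using c by (auto simp: open_segment_def)
    have ca: "closed_segment c a \<subseteq> {0..1}"
      using a01 c01 by (intro closed_segment_subset) auto
    \<comment> \<open>The Archimedean property takes two arcs with a common start, here
      \<open>m c\<close>: a piece of \<open>m\<close> ending at \<open>m a\<close>, and a segment to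
      \<open>z\<close>, which stays in \<open>X\<close> by convexity.\<close>
    have "m \<circ> linepath c a \<in> smooth_arcs_to_from X (m a) (m c)"
      using smooth_arc_subarc[OF sm c01 a01 \<open>c \<noteq> a\<close>] ca mX
      by (auto simp: smooth_arcs_to_from_def smooth_arcs_in_def path_image_compose)
        (auto simp: linepath_def)
    moreover have "linepath (m c) z \<in> smooth_arcs_to_from X z (m c)"
      using smooth_arc_linepath[OF mc] closed_segment_subset[OF mX[OF c01] \<open>z \<in> X\<close> \<open>convex X\<close>]
      by (simp add: smooth_arcs_to_from_def smooth_arcs_in_def) (simp add: linepath_def)
    ultimately obtain s where s: "s \<in> {0<..<1}" "strict R ((m \<circ> linepath c a) s) z"
      using arch xz mX[OF a01] mX[OF c01] \<open>z \<in> X\<close> unfolding strongly_Archimedean_def by blast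
    have l: "linepath c a s \<in> open_segment a c"
      using s(1) \<open>c \<noteq> a\<close> by (auto simp: open_segment_commute[of a] in_segment linepath_def)
    moreover have "open_segment a c \<subseteq> open_segment a b"
      using c open_closed_segment by (auto simp: subset_open_segment)
    ultimately have "linepath c a s \<in> open_segment a b" by blast
    moreover from this have "linepath c a s \<in> {0..1}"
      using ab open_closed_segment by blast
    then have "linepath c a s \<in> W"
      using s(2) by (simp add: W_def strict_def)
    ultimately show ?thesis by blast
  qed
  ultimately have "openin (top_of_set {0..1}) (W - V)"
    by (intro openin_diff_if_meets_open_segments) (auto simp: W_def)
  moreover have "W - V = {t \<in> {0..1}. strict R (m t) z}"
    by (auto simp: W_def V_def strict_def)
  ultimately show ?thesis by simp
qed

section \<open>Reversing the relation, and the return to arc-continuity\<close>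

lemma strict_conversep: "strict (R\<inverse>\<inverse>) = (strict R)\<inverse>\<inverse>"
  by (auto simp: strict_def fun_eq_iff)

lemma strongly_mixture_continuous_conversep:
  "strongly_mixture_continuous X (R\<inverse>\<inverse>) \<longleftrightarrow> strongly_mixture_continuous X R"
  by (auto simp: strongly_mixture_continuous_def)

text \<open>Reversal swaps \<open>x\<close> with \<open>y\<close> and the two arcs, so the two
  conclusions change places.\<close>

lemma strongly_Archimedean_conversep:
  "strongly_Archimedean X R \<Longrightarrow> strongly_Archimedean X (R\<inverse>\<inverse>)"
  unfolding strongly_Archimedean_def strict_conversep conversep_iff by blast

text \<open>Closedness on a curve is mixture-continuity read in the parameter; openness is
  \<open>smooth_arc_openin_strict\<close>, applied to \<open>R\<close> and to its converse.\<close>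

lemma arc_continuousI_mixture_Archimedean:
  assumes "convex X" and mix: "strongly_mixture_continuous X R" and arch: "strongly_Archimedean X R"
  shows "arc_continuous X R"
  unfolding arc_continuous_def
proof (intro allI impI ballI)
  fix S z
  assume "smooth_curve S \<and> S \<subseteq> X" and z: "z \<in> X"
  then obtain m where m: "m \<in> smooth_arcs_in X" and S: "S = path_image m"
    by (auto simp: smooth_curve_def smooth_arcs_in_def)
  have path: "path m" and mX: "\<And>t. t \<in> {0..1} \<Longrightarrow> m t \<in> X"
    using m by (auto simp: smooth_arcs_in_def smooth_arc_def arc_def path_image_def)
  have eq: "{t \<in> {0..1}. m t \<in> section_of X Q z} = {t \<in> {0..1}. Q (m t) z}" for Q
    using mX by (auto simp: section_of_def)
  have "m \<in> smooth_arcs_to_from X (m 1) (m 0)" "m 1 \<in> X" "m 0 \<in> X"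
    using m mX by (auto simp: smooth_arcs_to_from_def)
  then have "closed {t \<in> {0..1}. R (m t) z}" "closed {t \<in> {0..1}. R z (m t)}"
    using mix z unfolding strongly_mixture_continuous_def by blast+
  moreover have "openin (top_of_set {0..1}) {t \<in> {0..1}. strict R (m t) z}"
    by (rule smooth_arc_openin_strict[OF \<open>convex X\<close> arch mix m z])
  moreover have "openin (top_of_set {0..1}) {t \<in> {0..1}. strict (R\<inverse>\<inverse>) (m t) z}"
    using smooth_arc_openin_strict[OF \<open>convex X\<close> strongly_Archimedean_conversep[OF arch] _ m z] mix
    by (simp add: strongly_mixture_continuous_conversep)
  ultimately show "closedin (top_of_set S) (section_of X R z \<inter> S) \<and>
      closedin (top_of_set S) (section_of X (R\<inverse>\<inverse>) z \<inter> S) \<and>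
      openin (top_of_set S) (section_of X (strict R) z \<inter> S) \<and>
      openin (top_of_set S) (section_of X ((strict R)\<inverse>\<inverse>) z \<inter> S)"
    by (simp add: S closedin_path_image_iff[OF path] openin_path_image_iff[OF path] eq strict_conversep
        del: atLeastAtMost_iff)
qed

theorem theorem7:
  fixes X :: "(real ^ 'n) set"
    and R :: "real ^ 'n \<Rightarrow> real ^ 'n \<Rightarrow> bool"
  assumes "convex X"
    and "open X \<or> polyhedron X"
  shows "(arc_continuous X R \<longleftrightarrow> continuous_relation X R) \<and>
    (continuous_relation X R \<longleftrightarrow>
      strongly_mixture_continuous X R \<and> strongly_Archimedean X R)"
  using arc_continuous_iff_continuous_relation[OF assms, of R]
    arc_continuous_imp_strongly_mixture_continuous[of X R]
    arc_continuous_imp_strongly_Archimedean[of X R]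
    arc_continuousI_mixture_Archimedean[OF assms(1), of R]
  by blast

end
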